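(* Let $G$ be a simple graph on the vertex set $[d]$ without isolated vertices, and let $\delta(\mathcal{P}(G),t)=\delta_0+\delta_1t+\cdots+\delta_{d-1}t^{d-1}$. Then $$E(\mathrm{FRAC}(G),t)=\frac{\delta(\mathcal{P}(G),t^2)+t^{2d-1}\delta(\mathcal{P}(G),1/t^2)}{(1-t^2)^{d+1}}=\frac{\delta_0+\delta_{d-1}t+\delta_1t^2+\delta_{d-2}t^3+\cdots+\delta_{d-1}t^{2d-2}+\delta_0t^{2d-1}}{(1-t^2)^{d+1}},$$ where the sequence $(\delta_0,\delta_{d-1},\delta_1,\delta_{d-2},\ldots,\delta_{d-1},\delta_0)$ is symmetric and unimodal. In addition, for all integers $k$, $$i^{\mathrm{odd}}(\mathrm{FRAC}(G),2k+1)=(-1)^d\,i^{\mathrm{even}}(\mathrm{FRAC}(G),-2k-4)=(-1)^d\,i(\mathcal{P}(G),-k-2).$$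
   Context: $\mathrm{FRAC}(G)=\{(x_1,\ldots,x_d)\in\mathbb{R}^d : x_i\ge 0\ (1\le i\le d),\ x_i+x_j\le 1\ ((i,j)\in E(G))\}$ with $E(G)$ the edge set, and $\mathcal{P}(G)=2\,\mathrm{FRAC}(G)$, a $d$-dimensional lattice polytope. For a rational polytope $P\subset\mathbb{R}^d$, $i(P,n)=\#(nP\cap\mathbb{Z}^d)$ and the Ehrhart series is $E(P,t)=1+\sum_{n\ge1}i(P,n)t^n$. For a lattice polytope $P$ of dimension $d$, $i(P,n)$ is a polynomial in $n$ and $E(P,t)=\delta(P,t)/(1-t)^{d+1}$ with $\delta(P,t)$ a polynomial (the $\delta$-polynomial). The function $i(\mathrm{FRAC}(G),n)$ is a quasi-polynomial of period at most $2$: there are polynomials $i^{\mathrm{odd}}(\mathrm{FRAC}(G),n)$ and $i^{\mathrm{even}}(\mathrm{FRAC}(G),n)$ of degree $d$ with $i(\mathrm{FRAC}(G),n)=i^{\mathrm{odd}}(\mathrm{FRAC}(G),n)$ for odd $n\ge1$ and $=i^{\mathrm{even}}(\mathrm{FRAC}(G),n)$ for even $n\ge0$; these polynomials are evaluated at arbitrary integers. A sequence $(c_0,\ldots,c_m)$ is symmetric if $c_i=c_{m-i}$, and unimodal if $c_0\le\cdots\le c_k\ge\cdots\ge c_m$ for some $k$. *)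

theory Defs
  imports
    "HOL-Analysis.Analysis"
    "HOL-Computational_Algebra.Computational_Algebra"
begin

section \<open>Ehrhart theory\<close>

definition integer_points :: "(real ^ 'n) set" where
  "integer_points = {x. \<forall>i. x $ i \<in> \<int>}"

definition ehrhart_count :: "(real ^ 'n) set \<Rightarrow> nat \<Rightarrow> nat" where
  "ehrhart_count P n = card ((\<lambda>x. real n *\<^sub>R x) ` P \<inter> integer_points)"

definition ehrhart_series :: "(real ^ 'n) set \<Rightarrow> real fps" where
  "ehrhart_series P = Abs_fps (\<lambda>n. if n = 0 then 1 else real (ehrhart_count P n))"

text \<open>
  The following polynomials are determined by their defining property whenever some polynomial
  has it (see the lemmas below). For a lattice polytope, respectively for a rational polytope
  whose Ehrhart quasi-polynomial has period at most 2, existence is Ehrhart's theorem.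
\<close>

definition ehrhart_poly :: "(real ^ 'n) set \<Rightarrow> real poly" where
  "ehrhart_poly P = (THE p. \<forall>n\<ge>1. poly p (real n) = real (ehrhart_count P n))"

definition ehrhart_odd_poly :: "(real ^ 'n) set \<Rightarrow> real poly" where
  "ehrhart_odd_poly P = (THE p. \<forall>n. odd n \<longrightarrow> poly p (real n) = real (ehrhart_count P n))"

definition ehrhart_even_poly :: "(real ^ 'n) set \<Rightarrow> real poly" where
  "ehrhart_even_poly P = (THE p. \<forall>n. even n \<longrightarrow> poly p (real n) = real (ehrhart_count P n))"

definition delta_poly :: "(real ^ 'n) set \<Rightarrow> real poly" where
  "delta_poly P =
     (THE p. ehrhart_series P = fps_of_poly p / (1 - fps_X) ^ (nat (aff_dim P) + 1))"

lemma poly_eqI_infinite_nat: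
  fixes p q :: "real poly"
  assumes "infinite A" and "\<And>n. n \<in> A \<Longrightarrow> poly p (real n) = poly q (real n)"
  shows "p = q"
proof (rule ccontr)
  assume "p \<noteq> q"
  then have "finite {x. poly (p - q) x = 0}"
    by (intro poly_roots_finite) simp
  moreover have "real ` A \<subseteq> {x. poly (p - q) x = 0}"
    using assms(2) by auto
  ultimately have "finite (real ` A)"
    by (rule rev_finite_subset)
  then show False
    using assms(1) by (simp add: finite_image_iff inj_on_def)
qed

lemma infinite_ge_odd_even:
  "infinite {n::nat. n \<ge> 1}" "infinite {n::nat. odd n}" "infinite {n::nat. even n}"
proof -
  show "infinite {n::nat. n \<ge> 1}"
    using infinite_Ici[of "1::nat"] by (simp add: atLeast_def)
  have "range (\<lambda>n::nat. 2 * n + 1) \<subseteq> {n. odd n}" and "range (\<lambda>n::nat. 2 * n) \<subseteq> {n. even n}"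
    by auto
  moreover have "infinite (range (\<lambda>n::nat. 2 * n + 1))" and "infinite (range (\<lambda>n::nat. 2 * n))"
    by (auto intro!: range_inj_infinite injI)
  ultimately show "infinite {n::nat. odd n}" and "infinite {n::nat. even n}"
    using infinite_super by blast+
qed

lemma ehrhart_poly_eqI:
  assumes "\<And>n. n \<ge> 1 \<Longrightarrow> poly p (real n) = real (ehrhart_count P n)"
  shows "ehrhart_poly P = p"
  unfolding ehrhart_poly_def
  by (rule the_equality)
     (use assms in \<open>auto intro: poly_eqI_infinite_nat[OF infinite_ge_odd_even(1)]\<close>)

lemma ehrhart_odd_poly_eqI:
  assumes "\<And>n. odd n \<Longrightarrow> poly p (real n) = real (ehrhart_count P n)"
  shows "ehrhart_odd_poly P = p"
  unfolding ehrhart_odd_poly_def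
  by (rule the_equality)
     (use assms in \<open>auto intro: poly_eqI_infinite_nat[OF infinite_ge_odd_even(2)]\<close>)

lemma ehrhart_even_poly_eqI:
  assumes "\<And>n. even n \<Longrightarrow> poly p (real n) = real (ehrhart_count P n)"
  shows "ehrhart_even_poly P = p"
  unfolding ehrhart_even_poly_def
  by (rule the_equality)
     (use assms in \<open>auto intro: poly_eqI_infinite_nat[OF infinite_ge_odd_even(3)]\<close>)

lemma delta_poly_eqI:
  assumes "ehrhart_series P = fps_of_poly p / (1 - fps_X) ^ (nat (aff_dim P) + 1)"
  shows "delta_poly P = p"
  unfolding delta_poly_def
proof (rule the_equality)
  fix q
  let ?u = "(1 - fps_X :: real fps) ^ (nat (aff_dim P) + 1)"
  assume "ehrhart_series P = fps_of_poly q / ?u"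
  then have eq: "fps_of_poly q / ?u = fps_of_poly p / ?u"
    using assms by simp
  have unit: "?u dvd 1"
    by (intro fps_is_unit_iff[THEN iffD2]) (simp add: fps_nth_power_0)
  then have "fps_of_poly q = fps_of_poly p"
    using eq by (metis dvd_div_mult_self dvd_trans one_dvd)
  then show "q = p"
    by (simp add: fps_of_poly_eq_iff)
qed (rule assms)

section \<open>Graphs on the coordinate set and the fractional stable set polytope\<close>

text \<open>
  The vertex set is the finite index type of the coordinates, so that its cardinality is
  the \<open>d\<close> of the ambient space; a graph is given by its set of edges.
\<close>

definition simple_graph :: "'n set set \<Rightarrow> bool" where
  "simple_graph E \<longleftrightarrow> (\<forall>e\<in>E. card e = 2)"

definition no_isolated_vertices :: "'n set set \<Rightarrow> bool" where
  "no_isolated_vertices E \<longleftrightarrow> (\<forall>v. \<exists>e\<in>E. v \<in> e)"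

definition FRAC :: "'n set set \<Rightarrow> (real ^ 'n) set" where
  "FRAC E = {x. (\<forall>i. 0 \<le> x $ i) \<and> (\<forall>i j. {i, j} \<in> E \<longrightarrow> x $ i + x $ j \<le> 1)}"

definition two_FRAC :: "'n set set \<Rightarrow> (real ^ 'n) set" where
  "two_FRAC E = (\<lambda>x. 2 *\<^sub>R x) ` FRAC E"

section \<open>Finite sequences \<open>c\<^sub>0, \<dots>, c\<^sub>m\<close>\<close>

definition symmetric_seq :: "nat \<Rightarrow> (nat \<Rightarrow> 'a) \<Rightarrow> bool" where
  "symmetric_seq m c \<longleftrightarrow> (\<forall>i\<le>m. c i = c (m - i))"

definition unimodal_seq :: "nat \<Rightarrow> (nat \<Rightarrow> 'a::order) \<Rightarrow> bool" where
  "unimodal_seq m c \<longleftrightarrow>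
     (\<exists>k\<le>m. (\<forall>i<k. c i \<le> c (Suc i)) \<and> (\<forall>i. k \<le> i \<and> i < m \<longrightarrow> c (Suc i) \<le> c i))"

text \<open>
  For a polynomial \<open>\<delta>\<^sub>0 + \<dots> + \<delta>\<^bsub>d-1\<^esub> t\<^bsup>d-1\<^esup>\<close>, the sequence
  \<open>\<delta>\<^sub>0, \<delta>\<^bsub>d-1\<^esub>, \<delta>\<^sub>1, \<delta>\<^bsub>d-2\<^esub>, \<dots>, \<delta>\<^bsub>d-1\<^esub>, \<delta>\<^sub>0\<close> with indices \<open>0, \<dots>, 2d - 1\<close>.
\<close>

definition interleaved :: "nat \<Rightarrow> 'a::zero poly \<Rightarrow> nat \<Rightarrow> 'a" where
  "interleaved d \<delta> j =
     (if even j then coeff \<delta> (j div 2) else coeff \<delta> (d - 1 - j div 2))"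

text \<open>
  Evaluation in the field of formal Laurent series, where the arguments \<open>t\<^sup>2\<close> and \<open>1/t\<^sup>2\<close>
  are both available.
\<close>

definition poly_fls :: "'a::comm_ring_1 poly \<Rightarrow> 'a fls \<Rightarrow> 'a fls" where
  "poly_fls p = poly (map_poly fls_const p)"

end

theory Submission
  imports Defs
begin

text \<open>
  The substitution sending \<open>x\<^sub>i\<close> to \<open>2 x\<^sub>i\<close> if \<open>2 x\<^sub>i \<le> n\<close> and to \<open>2 (n - x\<^sub>i) + 1\<close> otherwise turns
  the integer points of \<open>n FRAC(G)\<close> into the labellings of the vertices by \<open>0, \<dots>, n\<close> in which every
  vertex with an odd label has a larger label than all its neighbours. Order the vertices by
  their labels and cut this order into maximal runs of labels of equal parity. A run of \<open>m\<close>
  vertices contributes \<open>t A\<^sub>m(t\<^sup>2) / (1 - t\<^sup>2)\<^sup>m\<close>, with \<open>A\<^sub>m\<close> the Eulerian polynomial, so that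
  \<open>t (1 - t) (1 - t\<^sup>2)\<^sup>d E(FRAC(G), t)\<close> is a sum of products of the \<open>t A\<^sub>m(t\<^sup>2)\<close>, the sizes \<open>m\<close> adding up
  to \<open>d\<close>. By gamma-positivity of the Eulerian polynomials each product is a nonnegative combination of
  the \<open>t\<^sup>j (1 + t\<^sup>2)\<^bsup>d-j\<^esup>\<close>. This makes the numerator of \<open>E(FRAC(G), t)\<close> over \<open>(1 - t\<^sup>2)\<^bsup>d+1\<^esup>\<close> symmetric
  and unimodal; its even part is \<open>\<delta>(t\<^sup>2)\<close>, and the reciprocity is its symmetry.
\<close>

section \<open>Lattice points as vertex labellings\<close>

lemma sum_card_power_Pow:
  fixes x :: "'b::comm_semiring_1"
  assumes "finite B"
  shows "(\<Sum>D\<in>Pow B. x ^ card D) = (1 + x) ^ card B"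
  using assms
proof (induction B rule: finite_induct)
  case (insert b B)
  have inj: "inj_on (insert b) (Pow B)"
    using insert.hyps by (auto simp: inj_on_def)
  have disj: "Pow B \<inter> insert b ` Pow B = {}"
    using insert.hyps by auto
  have "(\<Sum>D\<in>insert b ` Pow B. x ^ card D) = (\<Sum>D\<in>Pow B. x * x ^ card D)"
    unfolding sum.reindex[OF inj] o_def
  proof (rule sum.cong)
    fix D assume "D \<in> Pow B"
    then show "x ^ card (insert b D) = x * x ^ card D"
      using insert.hyps finite_subset[of D B] by (subst card_insert_disjoint) auto
  qed simp
  then show ?case
    using insert disj
    by (simp add: Pow_insert sum.union_disjoint sum_distrib_left[symmetric] algebra_simps)
qed simp

text \<open>
  Labels on the remaining vertex set \<open>S\<close> are counted from a level whose parity is odd iff \<open>p\<close>;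
  a removable set is one that may occupy the lowest level, or the lowest run.
\<close>

definition removable :: "'n set set \<Rightarrow> bool \<Rightarrow> 'n set \<Rightarrow> 'n set \<Rightarrow> bool" where
  "removable E p S B \<longleftrightarrow> B \<subseteq> S \<and> (p \<longrightarrow> (\<forall>i\<in>B. \<forall>j\<in>S. {i, j} \<notin> E))"

definition labellings :: "'n set set \<Rightarrow> bool \<Rightarrow> 'n set \<Rightarrow> nat \<Rightarrow> ('n \<Rightarrow> nat) set" where
  "labellings E p S n = {v. (\<forall>i. v i \<le> n) \<and> (\<forall>i. i \<notin> S \<longrightarrow> v i = 0) \<and>
     (\<forall>i\<in>S. odd (v i) \<noteq> p \<longrightarrow> (\<forall>j\<in>S. {i, j} \<in> E \<longrightarrow> v j < v i))}"

lemma removable_empty [simp]: "removable E p S {}"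
  by (simp add: removable_def)

text \<open>Edges are unordered, so an edge from \<open>D\<close> back to \<open>C\<close> is
  already excluded when \<open>C\<close> is removed. This allows a run to be taken off level by
  level.\<close>

lemma removable_Un:
  assumes "C \<inter> D = {}"
  shows "removable E p S (C \<union> D) \<longleftrightarrow> removable E p S C \<and> removable E p (S - C) D"
proof -
  have "{i, j} \<notin> E" if C: "\<forall>i\<in>C. \<forall>j\<in>S. {i, j} \<notin> E"
    and D: "\<forall>i\<in>D. \<forall>j\<in>S - C. {i, j} \<notin> E" "i \<in> D" "j \<in> S" "D \<subseteq> S - C" for i j
  proof (cases "j \<in> C")
    case True
    then have "{j, i} \<notin> E"
      using C D by blast
    then show ?thesis
      by (simp add: insert_commute)
  qed (use D in blast)
  then show ?thesis
    using assms unfolding removable_def by blast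
qed

lemma finite_labellings [simp]: "finite (labellings E p (S :: 'n::finite set) n)"
proof (rule finite_subset)
  show "labellings E p S n \<subseteq> PiE UNIV (\<lambda>_. {..n})"
    by (auto simp: labellings_def)
qed (simp add: finite_PiE)

lemma labellings_0:
  "labellings E p S 0 = (if removable E p S S then {\<lambda>_. 0} else {})"
  by (auto simp: labellings_def removable_def fun_eq_iff)

text \<open>Taking off the vertices with label 0 and lowering all other labels by one flips every
  parity, whence \<open>\<not> p\<close>. Truncated subtraction keeps the labels on \<open>B\<close>
  at 0, the value demanded outside \<open>S - B\<close>.\<close>

lemma card_labellings_zero_level:
  assumes "removable E p S B"
  shows "card {v \<in> labellings E p S (Suc n). {i \<in> S. v i = 0} = B} =
    card (labellings E (\<not> p) (S - B) n)"
proof (rule bij_betw_same_card)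
  show "bij_betw (\<lambda>v i. v i - 1) {v \<in> labellings E p S (Suc n). {i \<in> S. v i = 0} = B}
    (labellings E (\<not> p) (S - B) n)"
  proof (rule bij_betw_byWitness[where f' = "\<lambda>v i. if i \<in> S - B then Suc (v i) else 0"])
    show "\<forall>v\<in>{v \<in> labellings E p S (Suc n). {i \<in> S. v i = 0} = B}.
        (\<lambda>i. if i \<in> S - B then Suc (v i - 1) else 0) = v"
      by (auto simp: labellings_def fun_eq_iff)
    show "\<forall>v\<in>labellings E (\<not> p) (S - B) n.
        (\<lambda>i. (if i \<in> S - B then Suc (v i) else 0) - 1) = v"
      by (auto simp: labellings_def fun_eq_iff)
    show "(\<lambda>v i. v i - 1) ` {v \<in> labellings E p S (Suc n). {i \<in> S. v i = 0} = B}
      \<subseteq> labellings E (\<not> p) (S - B) n"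
    proof clarify
      fix v assume v: "v \<in> labellings E p S (Suc n)" and B: "B = {i \<in> S. v i = 0}"
      have "v j - 1 < v i - 1"
        if "i \<in> S" "v i \<noteq> 0" "j \<in> S" "v j \<noteq> 0" "odd (v i - 1) \<noteq> (\<not> p)" "{i, j} \<in> E" for i j
      proof -
        have "odd (v i) \<noteq> p"
          using that by (cases "v i") auto
        then have "v j < v i"
          using that v by (auto simp: labellings_def)
        then show ?thesis
          using that by simp
      qed
      with v show "(\<lambda>i. v i - 1) \<in> labellings E (\<not> p) (S - {i \<in> S. v i = 0}) n"
        by (auto simp: labellings_def diff_le_mono le_diff_conv)
    qed
    show "(\<lambda>v i. if i \<in> S - B then Suc (v i) else 0) ` labellings E (\<not> p) (S - B) n
      \<subseteq> {v \<in> labellings E p S (Suc n). {i \<in> S. v i = 0} = B}"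
      using assms unfolding labellings_def removable_def by (auto split: if_splits)
  qed
qed

lemma card_labellings_Suc:
  fixes S :: "'n::finite set"
  shows "card (labellings E p S (Suc n)) =
    (\<Sum>B | removable E p S B. card (labellings E (\<not> p) (S - B) n))"
proof -
  let ?L = "labellings E p S (Suc n)"
  have zero_level: "removable E p S {i \<in> S. v i = 0}" if "v \<in> ?L" for v
    using that unfolding labellings_def removable_def by force
  have "card ?L = (\<Sum>B | removable E p S B. card {v \<in> ?L. {i \<in> S. v i = 0} = B})"
    using sum.group[of ?L "{B. removable E p S B}" "\<lambda>v. {i \<in> S. v i = 0}" "\<lambda>_. 1 :: nat"]
      zero_level by (simp add: image_subset_iff)
  then show ?thesis
    by (simp add: card_labellings_zero_level)
qed

definition labelling_series :: "'n set set \<Rightarrow> bool \<Rightarrow> 'n set \<Rightarrow> real fps" where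
  "labelling_series E p S = Abs_fps (\<lambda>n. real (card (labellings E p S n)))"

lemma labelling_series_rec:
  fixes S :: "'n::finite set"
  shows "labelling_series E p S = of_bool (removable E p S S) +
    fps_X * (\<Sum>B | removable E p S B. labelling_series E (\<not> p) (S - B))"
proof (rule fps_ext)
  fix n
  show "labelling_series E p S $ n = (of_bool (removable E p S S) +
    fps_X * (\<Sum>B | removable E p S B. labelling_series E (\<not> p) (S - B))) $ n"
    by (cases n) (auto simp: labelling_series_def labellings_0 card_labellings_Suc fps_sum_nth)
qed

text \<open>
  The coefficient of \<open>t\<^bsup>2k+1\<^esup>\<close> counts the maps from \<open>m\<close> points to \<open>0, 2, \<dots>, 2k\<close> with maximum \<open>2k\<close>; the
  extra factor \<open>t\<close> is the step of odd length to the next run.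
\<close>

definition run_series :: "nat \<Rightarrow> real fps" where
  "run_series m =
     Abs_fps (\<lambda>n. if odd n then real (n div 2 + 1) ^ m - real (n div 2) ^ m else 0)"

text \<open>Either all of \<open>B\<close> lies on the lowest level of the run, which gives
  \<open>fps_X\<close>, or \<open>D\<close> is the nonempty set of vertices above that level, and
  dropping the level shortens the run by 2. The computation is the binomial theorem for both powers
  in \<open>run_series\<close>.\<close>

lemma run_series_rec:
  assumes "finite B" and "B \<noteq> {}"
  shows "run_series (card B) = fps_X + fps_X ^ 2 * (\<Sum>D\<in>Pow B - {{}}. run_series (card D))"
proof (rule fps_ext)
  fix n
  have pow: "(\<Sum>D\<in>Pow B - {{}}. x ^ card D) = (1 + x) ^ card B - 1" for x :: real
    using assms(1) by (simp add: sum_diff1 sum_card_power_Pow)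
  have nth: "(\<Sum>D\<in>Pow B - {{}}. run_series (card D)) $ k =
      (if odd k then (1 + real (k div 2 + 1)) ^ card B - (1 + real (k div 2)) ^ card B else 0)" for k
    unfolding fps_sum_nth run_series_def
    by (simp add: sum_subtractf pow del: of_nat_add of_nat_Suc)
  consider "n = 0" | "n = 1" | k where "n = Suc (Suc k)"
    by (metis One_nat_def not0_implies_Suc)
  then show "run_series (card B) $ n =
      (fps_X + fps_X ^ 2 * (\<Sum>D\<in>Pow B - {{}}. run_series (card D))) $ n"
  proof cases
    case 3
    then show ?thesis
      by (simp add: fps_X_power_mult_nth nth) (simp add: run_series_def)
  qed (use assms in \<open>simp_all add: fps_X_power_mult_nth run_series_def card_gt_0_iff\<close>)
qed

section \<open>Decomposition into runs\<close>

text \<open>Sums over all ways to cut \<open>S\<close> into nonempty runs, lowest first, with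
  parities alternating from \<open>p\<close> on; the weight of a run depends only on its
  size.\<close>

function run_sum :: "'n::finite set set \<Rightarrow> bool \<Rightarrow> 'n set \<Rightarrow> real fps" where
  "run_sum E p S = (if S = {} then 1 else
     (\<Sum>B | removable E p S B \<and> B \<noteq> {}. run_series (card B) * run_sum E (\<not> p) (S - B)))"
  by auto
termination
  by (relation "Wellfounded.measure (\<lambda>(E, p, S). card S)")
     (auto simp: removable_def intro!: psubset_card_mono)

declare run_sum.simps [simp del]

lemma run_sum_empty [simp]: "run_sum E p {} = 1"
  by (simp add: run_sum.simps)

lemma run_sum_rec:
  "S \<noteq> {} \<Longrightarrow> run_sum E p S =
     (\<Sum>B | removable E p S B \<and> B \<noteq> {}. run_series (card B) * run_sum E (\<not> p) (S - B))"
  by (subst run_sum.simps) simp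

text \<open>Takes off a single level instead of a whole run, to match
  \<open>labelling_series_rec\<close>. In \<open>run_series_rec\<close> for the lowest run, the term
  \<open>fps_X\<close> means that the run ends after one level and the parity changes; in the other
  term the run continues two steps higher.\<close>

lemma run_sum_level:
  fixes S :: "'n::finite set"
  assumes "S \<noteq> {}"
  shows "run_sum E p S =
    fps_X * (\<Sum>B | removable E p S B \<and> B \<noteq> {}. run_sum E (\<not> p) (S - B)) +
    fps_X ^ 2 * (\<Sum>B | removable E p S B \<and> B \<noteq> S. run_sum E p (S - B))"
proof -
  let ?r = "\<lambda>D. run_series (card D)" and ?Z = "run_sum E (\<not> p)"
  let ?I = "{B. removable E p S B \<and> B \<noteq> {}}" and ?J = "{C. removable E p S C \<and> C \<noteq> S}"
  let ?K = "\<lambda>C. {D. removable E p (S - C) D \<and> D \<noteq> {}}"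
  have "run_sum E p S = (\<Sum>B\<in>?I. (fps_X + fps_X ^ 2 * (\<Sum>D\<in>Pow B - {{}}. ?r D)) * ?Z (S - B))"
    unfolding run_sum_rec[OF assms] by (intro sum.cong) (auto simp: run_series_rec)
  also have "\<dots> = fps_X * (\<Sum>B\<in>?I. ?Z (S - B)) +
      fps_X ^ 2 * (\<Sum>B\<in>?I. \<Sum>D\<in>Pow B - {{}}. ?r D * ?Z (S - B))"
    by (simp add: sum_distrib_left sum_distrib_right sum.distrib algebra_simps)
  also have "(\<Sum>B\<in>?I. \<Sum>D\<in>Pow B - {{}}. ?r D * ?Z (S - B)) =
      (\<Sum>(B, D)\<in>(SIGMA B:?I. Pow B - {{}}). ?r D * ?Z (S - B))"
    by (rule sum.Sigma) auto
  \<comment> \<open>A run \<open>B\<close> splits into its lowest level \<open>C\<close> and the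
    nonempty rest \<open>D\<close>, which is itself the lowest run of \<open>S - C\<close>. As
    \<open>D\<close> is nonempty, \<open>C\<close> differs from \<open>S\<close>.\<close>
  also have "\<dots> = (\<Sum>(C, D)\<in>(SIGMA C:?J. ?K C). ?r D * ?Z (S - C - D))"
  proof (rule sum.reindex_bij_witness[where i = "\<lambda>(C, D). (C \<union> D, D)" and j = "\<lambda>(B, D). (B - D, D)"])
    fix x assume x: "x \<in> (SIGMA B:?I. Pow B - {{}})"
    obtain B D where [simp]: "x = (B, D)" by (cases x)
    have B: "removable E p S B" "D \<subseteq> B" "D \<noteq> {}" using x by auto
    have "removable E p S ((B - D) \<union> D)"
      using B by (simp add: Un_absorb2 Diff_partition Un_commute)
    then have "removable E p S (B - D) \<and> removable E p (S - (B - D)) D"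
      by (subst (asm) removable_Un) auto
    moreover have "B - D \<noteq> S"
      using B by (auto simp: removable_def)
    ultimately show "(case x of (B, D) \<Rightarrow> (B - D, D)) \<in> (SIGMA C:?J. ?K C)"
      using B by auto
    have "S - (B - D) - D = S - B" using B by auto
    then show "(case case x of (B, D) \<Rightarrow> (B - D, D) of (C, D) \<Rightarrow> ?r D * ?Z (S - C - D)) =
        (case x of (B, D) \<Rightarrow> ?r D * ?Z (S - B))"
      by simp
    show "(case case x of (B, D) \<Rightarrow> (B - D, D) of (C, D) \<Rightarrow> (C \<union> D, D)) = x"
      using B by auto
  next
    fix x assume x: "x \<in> (SIGMA C:?J. ?K C)"
    obtain C D where [simp]: "x = (C, D)" by (cases x)
    have C: "removable E p S C" "removable E p (S - C) D" "D \<noteq> {}" using x by auto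
    have "C \<inter> D = {}" using C by (auto simp: removable_def)
    then show "(case case x of (C, D) \<Rightarrow> (C \<union> D, D) of (B, D) \<Rightarrow> (B - D, D)) = x"
      by auto
    show "(case x of (C, D) \<Rightarrow> (C \<union> D, D)) \<in> (SIGMA B:?I. Pow B - {{}})"
      using C \<open>C \<inter> D = {}\<close> by (auto simp: removable_Un)
  qed
  also have "\<dots> = (\<Sum>C\<in>?J. \<Sum>D\<in>?K C. ?r D * ?Z (S - C - D))"
    by (rule sum.Sigma[symmetric]) auto
  also have "\<dots> = (\<Sum>C\<in>?J. run_sum E p (S - C))"
    by (intro sum.cong refl run_sum_rec[symmetric]) (auto simp: removable_def)
  finally show ?thesis .
qed

text \<open>Both sides satisfy the recursion of \<open>labelling_series_rec\<close>, which has a unique solution.\<close>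

lemma labelling_series_run_sum:
  fixes S :: "'n::finite set"
  shows "fps_X * (1 - fps_X) * labelling_series E p S =
    run_sum E p S + fps_X * run_sum E (\<not> p) S - of_bool (S = {})"
proof -
  define rhs :: "bool \<Rightarrow> 'n set \<Rightarrow> real fps"
    where "rhs p S = run_sum E p S + fps_X * run_sum E (\<not> p) S - of_bool (S = {})" for p S
  let ?a = "\<lambda>p S. of_bool (removable E p S S) :: real fps"
  have removable_Nil: "{B. removable E p {} B} = {{}}" for p
    by (auto simp: removable_def)
  have rhs_rec: "rhs p S = fps_X * (1 - fps_X) * ?a p S +
      fps_X * (\<Sum>B | removable E p S B. rhs (\<not> p) (S - B))" for p S
  proof (cases "S = {}")
    case True
    then show ?thesis
      by (simp add: rhs_def removable_Nil algebra_simps)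
  next
    case False
    have sum_of_bool: "(\<Sum>B | removable E p S B. of_bool (S - B = {})) = ?a p S"
    proof -
      have "(\<Sum>B | removable E p S B. of_bool (S - B = {})) =
          (\<Sum>B | removable E p S B. if B = S then 1 else 0 :: real fps)"
        by (intro sum.cong) (auto simp: removable_def)
      then show ?thesis
        by simp
    qed
    \<comment> \<open>\<open>run_sum_level\<close> omits \<open>B = S\<close> from one sum and
      \<open>B = {}\<close> from the other; restoring these terms gives sums over all removable
      sets.\<close>
    have split_S: "(\<Sum>B | removable E p S B. run_sum E p (S - B)) =
        ?a p S + (\<Sum>B | removable E p S B \<and> B \<noteq> S. run_sum E p (S - B))"
    proof (cases "removable E p S S")
      case True
      have "{B. removable E p S B} = insert S {B. removable E p S B \<and> B \<noteq> S}"
        using True by auto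
      then show ?thesis
        using True by simp
    next
      case False
      then have "{B. removable E p S B} = {B. removable E p S B \<and> B \<noteq> S}"
        by auto
      then show ?thesis
        using False by simp
    qed
    have split_empty: "(\<Sum>B | removable E p S B. run_sum E (\<not> p) (S - B)) =
        run_sum E (\<not> p) S + (\<Sum>B | removable E p S B \<and> B \<noteq> {}. run_sum E (\<not> p) (S - B))"
    proof -
      have "{B. removable E p S B} = insert {} {B. removable E p S B \<and> B \<noteq> {}}"
        by auto
      then show ?thesis
        by simp
    qed
    have sum_rhs: "(\<Sum>B | removable E p S B. rhs (\<not> p) (S - B)) =
        (\<Sum>B | removable E p S B. run_sum E (\<not> p) (S - B)) +
        fps_X * (\<Sum>B | removable E p S B. run_sum E p (S - B)) - ?a p S"
      unfolding sum_of_bool[symmetric]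
      by (simp add: rhs_def sum.distrib sum_subtractf sum_distrib_left)
    show ?thesis
      unfolding sum_rhs split_S split_empty rhs_def[of p S] run_sum_level[OF False, of E p]
      using False by (simp add: power2_eq_square algebra_simps)
  qed
  define diff where "diff p S = fps_X * (1 - fps_X) * labelling_series E p S - rhs p S" for p S
  have diff_rec: "diff p S = fps_X * (\<Sum>B | removable E p S B. diff (\<not> p) (S - B))" for p S
    unfolding diff_def by (subst rhs_rec, subst labelling_series_rec)
      (simp add: sum_subtractf sum.distrib sum_distrib_left algebra_simps)
  have "diff p S $ n = 0" for n
  \<comment> \<open>The factor \<open>fps_X\<close> determines each coefficient from the preceding
    ones. Induction on \<open>S\<close> would fail, since \<open>B = {}\<close> leaves
    \<open>S\<close> unchanged.\<close>
  proof (induction n arbitrary: p S)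
    case 0
    then show ?case by (subst diff_rec) simp
  next
    case (Suc n)
    then show ?case by (subst diff_rec) (simp add: fps_sum_nth)
  qed
  then have "diff p S = 0"
    by (simp add: fps_ext)
  then show ?thesis
    by (simp add: diff_def rhs_def)
qed

section \<open>Gamma-nonnegativity\<close>

text \<open>The cone spanned by the t^j (1 + t^2)^(N - j). Each generator is symmetric about the
  exponent N whatever j is, and a product of generators for N and M is a generator for N +
  M.\<close>

inductive gamma_nonneg :: "nat \<Rightarrow> real fps \<Rightarrow> bool" where
  zero: "gamma_nonneg N 0"
| add: "0 \<le> c \<Longrightarrow> N = j + e \<Longrightarrow> gamma_nonneg N f \<Longrightarrow>
    gamma_nonneg N (fps_const c * (fps_X ^ j * (1 + fps_X ^ 2) ^ e) + f)"

lemma gamma_nonneg_basis: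
  "0 \<le> c \<Longrightarrow> N = j + e \<Longrightarrow>
    gamma_nonneg N (fps_const c * (fps_X ^ j * (1 + fps_X ^ 2) ^ e))"
  using gamma_nonneg.add[OF _ _ gamma_nonneg.zero] by simp

lemma gamma_nonneg_plus:
  assumes "gamma_nonneg N f" and "gamma_nonneg N g"
  shows "gamma_nonneg N (f + g)"
  using assms by (induction) (auto simp: add.assoc intro: gamma_nonneg.add)

lemma gamma_nonneg_sum:
  "(\<And>x. x \<in> A \<Longrightarrow> gamma_nonneg N (f x)) \<Longrightarrow> gamma_nonneg N (\<Sum>x\<in>A. f x)"
  by (induction A rule: infinite_finite_induct)
    (auto intro: gamma_nonneg.zero gamma_nonneg_plus)

lemma gamma_nonneg_basis_mult:
  assumes "gamma_nonneg M g" and "0 \<le> c"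
  shows "gamma_nonneg (j + e + M) (fps_const c * (fps_X ^ j * (1 + fps_X ^ 2) ^ e) * g)"
  using assms(1)
proof induction
  case (add c' M j' e' g)
  have "gamma_nonneg (j + e + M)
      (fps_const (c * c') * (fps_X ^ (j + j') * (1 + fps_X ^ 2) ^ (e + e')))"
    using add \<open>0 \<le> c\<close> by (intro gamma_nonneg_basis) auto
  from gamma_nonneg_plus[OF this add.IH] show ?case
    by (simp add: power_add algebra_simps flip: fps_const_mult)
qed (simp add: gamma_nonneg.zero)

lemma gamma_nonneg_mult:
  assumes "gamma_nonneg N f" and "gamma_nonneg M g"
  shows "gamma_nonneg (N + M) (f * g)"
  using assms(1)
proof induction
  case (add c N j e f)
  then show ?case
    by (auto simp: distrib_right intro!: gamma_nonneg_plus gamma_nonneg_basis_mult assms(2))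
qed (simp add: gamma_nonneg.zero)

lemma nth_one_plus_fps_X_squared_power:
  "((1 + fps_X ^ 2) ^ e :: real fps) $ n = (if even n then real (e choose (n div 2)) else 0)"
proof (induction e arbitrary: n)
  case 0
  show ?case
    by (auto simp: binomial_eq_0_iff elim!: evenE)
next
  case (Suc e)
  consider "n = 0" | "n = 1" | k where "n = Suc (Suc k)"
    by (metis One_nat_def not0_implies_Suc)
  then show ?case
    by cases (simp_all add: distrib_right fps_X_power_mult_nth Suc.IH)
qed

lemma nth_gamma_basis:
  "(fps_X ^ j * (1 + fps_X ^ 2) ^ e :: real fps) $ n =
    (if j \<le> n \<and> even (n - j) then real (e choose ((n - j) div 2)) else 0)"
  by (auto simp: fps_X_power_mult_nth nth_one_plus_fps_X_squared_power)

text \<open>In t^j (1 + t^2)^e with j + e = N, reflection about N exchanges the exponents j + 2k and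
  j + 2(e - k), whose binomial coefficients agree.\<close>

lemma gamma_nonneg_symmetric:
  fixes f :: "real fps"
  assumes "gamma_nonneg N f" and "n \<le> 2 * N"
  shows "f $ n = f $ (2 * N - n)"
  using assms
proof induction
  case (add c N j e f)
  have "(fps_X ^ j * (1 + fps_X ^ 2) ^ e :: real fps) $ n =
      (fps_X ^ j * (1 + fps_X ^ 2) ^ e) $ (2 * N - n)"
  proof (cases "j \<le> n \<and> even (n - j)")
    case True
    then obtain k where n: "n = j + 2 * k"
      by (metis dvd_def le_add_diff_inverse)
    show ?thesis
    proof (cases "k \<le> e")
      case True
      then have "2 * N - n - j = 2 * (e - k)" and "j \<le> 2 * N - n"
        using add n by auto
      then show ?thesis
        using n True binomial_symmetric[OF True] by (simp only: nth_gamma_basis) simp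
    next
      case False
      then have "\<not> j \<le> 2 * N - n \<or> (j = 0 \<and> 2 * N - n = 0)"
        using add n by auto
      then show ?thesis
        using n False add by (auto simp: nth_gamma_basis)
    qed
  next
    case False
    show ?thesis
    proof (cases "n < j")
      case True
      \<comment> \<open>The mirror image of an exponent below \<open>j\<close> lies above the top
        exponent j + 2e.\<close>
      have "e < (2 * N - n - j) div 2" if "even (2 * N - n - j)"
      proof -
        from that obtain k where k: "2 * N - n - j = 2 * k"
          by (rule evenE)
        then show ?thesis
          using add.hyps(2) True by simp
      qed
      then show ?thesis
        using True by (simp only: nth_gamma_basis) simp
    next
      case nle: False
      have "\<not> (j \<le> 2 * N - n \<and> even (2 * N - n - j))"
      proof
        assume "j \<le> 2 * N - n \<and> even (2 * N - n - j)"
        then obtain l where "2 * N - n = j + 2 * l"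
          by (metis dvd_def le_add_diff_inverse)
        then have "n - j = 2 * (e - l)"
          using add.hyps(2) add.prems by simp
        then show False
          using False nle by simp
      qed
      then show ?thesis
        using False by (simp only: nth_gamma_basis if_False)
    qed
  qed
  then show ?case
    using add by simp
qed simp

lemma gamma_nonneg_nth_eq_0:
  fixes f :: "real fps"
  assumes "gamma_nonneg N f" and "2 * N < n"
  shows "f $ n = 0"
  using assms
proof induction
  case (add c N j e f)
  have "(fps_X ^ j * (1 + fps_X ^ 2) ^ e :: real fps) $ n = 0"
  proof (cases "j \<le> n \<and> even (n - j)")
    case True
    then obtain k where "n = j + 2 * k"
      by (metis dvd_def le_add_diff_inverse)
    then show ?thesis
      using add by (auto simp: nth_gamma_basis)
  qed (auto simp: nth_gamma_basis)
  then show ?case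
    using add by simp
qed simp

text \<open>A generator has exponents of one parity only, hence the step by 2. Along them its
  coefficients form a binomial row, and \<open>n + 2 \<le> N\<close> stays in the rising
  half.\<close>

lemma gamma_nonneg_nth_mono:
  fixes f :: "real fps"
  assumes "gamma_nonneg N f" and "n + 2 \<le> N"
  shows "f $ n \<le> f $ (n + 2)"
  using assms
proof induction
  case (add c N j e f)
  have "(fps_X ^ j * (1 + fps_X ^ 2) ^ e :: real fps) $ n \<le>
      (fps_X ^ j * (1 + fps_X ^ 2) ^ e) $ (n + 2)"
  proof (cases "j \<le> n \<and> even (n - j)")
    case True
    then obtain k where n: "n = j + 2 * k"
      by (metis dvd_def le_add_diff_inverse)
    have "e choose k \<le> e choose (k + 1)"
      using add n by (intro binomial_mono) auto
    moreover have "(n + 2 - j) div 2 = k + 1" "(n - j) div 2 = k" "even (n + 2 - j)"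
      using n by auto
    ultimately show ?thesis
      using True by (simp only: nth_gamma_basis) simp
  next
    case False
    then show ?thesis
      by (simp only: nth_gamma_basis) simp
  qed
  then show ?case
    using add by (simp add: add_mono mult_left_mono)
qed simp

section \<open>Eulerian polynomials and their gamma-positivity\<close>

text \<open>This is t A_m(t^2) / (1 - t^2)^(m + 1), with A_m the Eulerian polynomial.\<close>

definition odd_power_series :: "nat \<Rightarrow> real fps" where
  "odd_power_series m = Abs_fps (\<lambda>n. if odd n then real (n div 2 + 1) ^ m else 0)"

text \<open>Multiplication by t^2 shifts k to k + 1, so the factor produces the difference of
  powers. At t the subtracted power is 0^m, which vanishes only for positive m.\<close>

lemma run_series_eq:
  assumes "m > 0"
  shows "run_series m = (1 - fps_X ^ 2) * odd_power_series m"
proof (rule fps_ext)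
  fix n
  consider "n = 0" | "n = 1" | k where "n = Suc (Suc k)"
    by (metis One_nat_def not0_implies_Suc)
  then show "run_series m $ n = ((1 - fps_X ^ 2) * odd_power_series m) $ n"
    using assms
    by cases (simp_all add: run_series_def odd_power_series_def left_diff_distrib fps_X_power_mult_nth)
qed

lemma odd_power_series_0: "odd_power_series 0 * (1 - fps_X ^ 2) = fps_X"
proof (rule fps_ext)
  fix n
  consider "n = 0" | "n = 1" | k where "n = Suc (Suc k)"
    by (metis One_nat_def not0_implies_Suc)
  then show "(odd_power_series 0 * (1 - fps_X ^ 2)) $ n = fps_X $ n"
    by cases
      (simp_all add: odd_power_series_def right_diff_distrib fps_X_power_mult_right_nth)
qed

text \<open>Multiplying t^(2k+1) by t and differentiating brings down 2(k + 1), twice the missing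
  factor.\<close>

lemma odd_power_series_Suc:
  "odd_power_series (Suc m) = fps_const (1 / 2) * fps_deriv (fps_X * odd_power_series m)"
proof (rule fps_ext)
  fix n
  show "odd_power_series (Suc m) $ n =
      (fps_const (1 / 2) * fps_deriv (fps_X * odd_power_series m)) $ n"
    by (cases "odd n") (auto simp: odd_power_series_def field_simps elim!: oddE)
qed

text \<open>The recursion of the Eulerian polynomials \<open>A\<^sub>m\<close>, transported to \<open>t A\<^sub>m(t\<^sup>2)\<close>.\<close>

definition euler_step :: "nat \<Rightarrow> real fps \<Rightarrow> real fps" where
  "euler_step m f = fps_const (1 / 2) * ((1 - fps_X ^ 2) * fps_deriv (fps_X * f)) +
     fps_const (real (m + 1)) * (fps_X ^ 2 * f)"

text \<open>By the product rule for \<open>u ^ (m + 1)\<close>: the second summand of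
  \<open>euler_step\<close> cancels the term in which the power of \<open>u\<close> is
  differentiated.\<close>

lemma euler_step_odd_power_series:
  "odd_power_series (Suc m) * (1 - fps_X ^ 2) ^ (m + 2) =
    euler_step m (odd_power_series m * (1 - fps_X ^ 2) ^ (m + 1))"
proof -
  define u F c where "u = (1 - fps_X ^ 2 :: real fps)" and "F = fps_X * odd_power_series m"
    and "c = fps_const (2 * real (m + 1))"
  have "fps_deriv u = - (2 * fps_X)"
    by (simp add: u_def fps_deriv_power)
  then have du: "fps_deriv (u ^ (m + 1)) = - (c * (fps_X * u ^ m))"
    unfolding fps_deriv_power
    by (simp add: c_def numeral_fps_const mult_ac fps_const_mult[symmetric] del: fps_const_mult)
  have half: "fps_const (1 / 2) * c = fps_const (real (m + 1))"
    by (simp add: c_def)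
  have "fps_const (1 / 2) * (u * fps_deriv (F * u ^ (m + 1))) =
      fps_const (1 / 2) * fps_deriv F * (u * u ^ (m + 1)) -
      (fps_const (1 / 2) * c) * (fps_X * (F * u ^ (m + 1)))"
    unfolding fps_deriv_mult du by (simp add: algebra_simps)
  then show ?thesis
    unfolding euler_step_def odd_power_series_Suc half F_def u_def[symmetric]
    by (simp add: mult.assoc power2_eq_square)
qed

text \<open>The step is linear, and \<open>basis\<close> shows that it sends a generator to a
  nonnegative combination of two generators for \<open>Suc m\<close>. There m = j + e splits the
  coefficient m + 1 into j + 1, which pairs with the derivative of t^(j+1), and e, which pairs with
  that of (1 + t^2)^e.\<close>

lemma gamma_nonneg_euler_step:
  assumes "gamma_nonneg m f"
  shows "gamma_nonneg (Suc m) (euler_step m f)"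
  using assms
proof induction
  case (zero m)
  then show ?case
    by (simp add: euler_step_def gamma_nonneg.zero)
next
  case (add c m j e f)
  let ?w = "1 + fps_X ^ 2 :: real fps"
  have basis: "euler_step m (fps_X ^ j * ?w ^ e) =
      fps_const (real (j + 1) / 2) * (fps_X ^ j * ?w ^ (e + 1)) +
      fps_const (2 * real e) * (fps_X ^ (j + 2) * ?w ^ (e - 1))"
  proof -
    \<comment> \<open>The constants become atoms with \<open>2 * h = 1\<close>, which leaves
      identities in a commutative ring.\<close>
    define h J c' where "h = fps_const (1 / 2 :: real)" and "J = fps_const (real (j + 1))"
      and "c' = fps_const (real e)"
    have h: "2 * h = 1"
      by (simp add: h_def numeral_fps_const)
    have ring: "h * ((1 - x) * (J * y)) + J * (x * y) = h * J * (y * (1 + x))" for x y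
    proof -
      have "h * ((1 - x) * (J * y)) + 2 * h * (J * (x * y)) = h * J * (y * (1 + x))"
        by (simp add: algebra_simps)
      then show ?thesis
        by (simp add: h)
    qed
    have ring_Suc: "h * ((1 - fps_X ^ 2) * (J * (P * (?w * Q)) + fps_X * P * (c' * (2 * fps_X) * Q))) +
        (J + c') * (fps_X ^ 2 * (P * (?w * Q))) =
        h * J * (P * (?w * Q) * ?w) + 2 * c' * (fps_X * (fps_X * P) * Q)" for P Q
    proof -
      have "h * ((1 - fps_X ^ 2) * (fps_X * P * (c' * (2 * fps_X) * Q))) =
          (2 * h) * ((1 - fps_X ^ 2) * (fps_X ^ 2 * P * (c' * Q)))"
        by (simp add: power2_eq_square mult_ac)
      then have c': "h * ((1 - fps_X ^ 2) * (fps_X * P * (c' * (2 * fps_X) * Q))) +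
          c' * (fps_X ^ 2 * (P * (?w * Q))) = 2 * c' * (fps_X * (fps_X * P) * Q)"
        unfolding h by (simp add: power2_eq_square algebra_simps)
      have "h * ((1 - fps_X ^ 2) * (J * (P * (?w * Q)) + fps_X * P * (c' * (2 * fps_X) * Q))) +
          (J + c') * (fps_X ^ 2 * (P * (?w * Q))) =
          (h * ((1 - fps_X ^ 2) * (J * (P * (?w * Q)))) + J * (fps_X ^ 2 * (P * (?w * Q)))) +
          (h * ((1 - fps_X ^ 2) * (fps_X * P * (c' * (2 * fps_X) * Q))) +
          c' * (fps_X ^ 2 * (P * (?w * Q))))"
        by (simp only: distrib_left[of _ "J * (P * (?w * Q))"]
          distrib_left[of _ "(1 - fps_X ^ 2) * (J * (P * (?w * Q)))"] distrib_right[of J] add_ac)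
      then show ?thesis
        unfolding ring c' by simp
    qed
    have coeffs_eq: "fps_const (real (j + 1) / 2) = h * J" "fps_const (2 * real e) = 2 * c'"
        "fps_const (real (m + 1)) = J + c'"
      using add by (simp_all add: h_def J_def c'_def numeral_fps_const)
    have "fps_deriv (fps_X * (fps_X ^ j * ?w ^ e)) = fps_deriv (fps_X ^ (j + 1) * ?w ^ e)"
      by (simp add: mult.assoc)
    also have "\<dots> = J * fps_X ^ j * ?w ^ e + fps_X ^ (j + 1) * (c' * (2 * fps_X) * ?w ^ (e - 1))"
      by (simp add: fps_deriv_power J_def c'_def numeral_fps_const algebra_simps del: power_Suc)
    finally have deriv: "fps_deriv (fps_X * (fps_X ^ j * ?w ^ e)) = \<dots>" .
    show ?thesis
      unfolding euler_step_def deriv coeffs_eq h_def[symmetric]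
    proof (cases e)
      \<comment> \<open>The exponent \<open>e - 1\<close> is truncated here, but its coefficient is
        zero.\<close>
      case 0
      then have "c' = 0" by (simp add: c'_def)
      then show "h * ((1 - fps_X ^ 2) * (J * fps_X ^ j * ?w ^ e +
          fps_X ^ (j + 1) * (c' * (2 * fps_X) * ?w ^ (e - 1)))) +
          (J + c') * (fps_X ^ 2 * (fps_X ^ j * ?w ^ e)) =
          h * J * (fps_X ^ j * ?w ^ (e + 1)) + 2 * c' * (fps_X ^ (j + 2) * ?w ^ (e - 1))"
        using 0 ring[of "fps_X ^ 2" "fps_X ^ j"] by simp
    next
      case (Suc e')
      have powers: "?w ^ e = ?w * ?w ^ e'" "?w ^ (e + 1) = ?w * ?w ^ e' * ?w"
        "fps_X ^ (j + 1) = fps_X * (fps_X ^ j :: real fps)"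
        "fps_X ^ (j + 2) = fps_X * (fps_X * (fps_X ^ j :: real fps))" "?w ^ (e - 1) = ?w ^ e'"
        by (simp_all add: Suc mult.commute)
      show "h * ((1 - fps_X ^ 2) * (J * fps_X ^ j * ?w ^ e +
          fps_X ^ (j + 1) * (c' * (2 * fps_X) * ?w ^ (e - 1)))) +
          (J + c') * (fps_X ^ 2 * (fps_X ^ j * ?w ^ e)) =
          h * J * (fps_X ^ j * ?w ^ (e + 1)) + 2 * c' * (fps_X ^ (j + 2) * ?w ^ (e - 1))"
        unfolding powers using ring_Suc[of "fps_X ^ j" "?w ^ e'"] by (simp only: mult.assoc)
    qed
  qed
  have "gamma_nonneg (Suc m) (fps_const (c * (real (j + 1) / 2)) * (fps_X ^ j * ?w ^ (e + 1)))"
    using add by (intro gamma_nonneg_basis) auto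
  moreover have "gamma_nonneg (Suc m)
      (fps_const (c * (2 * real e)) * (fps_X ^ (j + 2) * ?w ^ (e - 1)))"
  proof (cases "e = 0")
    case False
    then show ?thesis
      using add by (intro gamma_nonneg_basis) auto
  qed (simp add: gamma_nonneg.zero)
  ultimately have "gamma_nonneg (Suc m) (fps_const c * euler_step m (fps_X ^ j * ?w ^ e))"
    unfolding basis distrib_left mult.assoc[symmetric] fps_const_mult
    by (rule gamma_nonneg_plus)
  moreover have "euler_step m (fps_const c * (fps_X ^ j * ?w ^ e) + f) =
      fps_const c * euler_step m (fps_X ^ j * ?w ^ e) + euler_step m f"
    by (simp add: euler_step_def algebra_simps)
  ultimately show ?case
    using add.IH by (simp add: gamma_nonneg_plus)
qed

text \<open>For exponent 0 the numerator is \<open>fps_X\<close>, with centre 1 instead of 0; so the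
  induction starts at exponent 1, where the numerator is again \<open>fps_X\<close>.\<close>

lemma gamma_nonneg_odd_power_series:
  "gamma_nonneg (Suc m) (odd_power_series (Suc m) * (1 - fps_X ^ 2) ^ (m + 2))"
proof (induction m)
  case 0
  have "odd_power_series (Suc 0) * (1 - fps_X ^ 2) ^ (0 + 2) = euler_step 0 fps_X"
    unfolding euler_step_odd_power_series by (simp add: odd_power_series_0)
  also have "\<dots> = fps_X"
  proof -
    have half: "fps_const (1 / 2) * (2 :: real fps) = 1"
      by (simp add: numeral_fps_const)
    have eq: "euler_step 0 fps_X =
        fps_const (1 / 2) * 2 * ((1 - fps_X ^ 2) * fps_X) + fps_X ^ 2 * fps_X"
      by (simp add: euler_step_def flip: mult_2)
    show ?thesis
      unfolding eq half by (simp add: algebra_simps)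
  qed
  finally show ?case
    using gamma_nonneg_basis[of 1 1 1 0] by simp
next
  case (Suc m)
  from gamma_nonneg_euler_step[OF this] show ?case
    using euler_step_odd_power_series[of "Suc m"] by simp
qed

lemma gamma_nonneg_run_series:
  assumes "m > 0"
  shows "gamma_nonneg m (run_series m * (1 - fps_X ^ 2) ^ m)"
proof -
  obtain k where "m = Suc k"
    using assms gr0_implies_Suc by blast
  then show ?thesis
    using gamma_nonneg_odd_power_series[of k] by (simp add: run_series_eq algebra_simps)
qed

text \<open>The run sizes add up to \<open>card S\<close>, so each run receives exactly the power of
  1 - t^2 that clears its denominator.\<close>

lemma gamma_nonneg_run_sum:
  "gamma_nonneg (card S) (run_sum E p S * (1 - fps_X ^ 2) ^ card S)"
proof (induction "card S" arbitrary: p S rule: less_induct)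
  case less
  show ?case
  proof (cases "S = {}")
    case True
    then show ?thesis
      using gamma_nonneg_basis[of 1 0 0 0] by simp
  next
    case False
    let ?u = "1 - fps_X ^ 2 :: real fps"
    have "gamma_nonneg (card S) (run_series (card B) * run_sum E (\<not> p) (S - B) * ?u ^ card S)"
      if B: "removable E p S B" "B \<noteq> {}" for B
    proof -
      have S: "card S = card B + card (S - B)"
        using B by (simp add: removable_def card_Diff_subset card_mono)
      have "card B > 0"
        using B by (simp add: card_gt_0_iff)
      then have "card (S - B) < card S"
        using S by simp
      have "run_series (card B) * run_sum E (\<not> p) (S - B) * ?u ^ card S =
          (run_series (card B) * ?u ^ card B) * (run_sum E (\<not> p) (S - B) * ?u ^ card (S - B))"
        unfolding S power_add by (simp only: mult_ac)
      moreover have "gamma_nonneg (card B + card (S - B)) \<dots>"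
        using \<open>card B > 0\<close> less \<open>card (S - B) < card S\<close>
        by (intro gamma_nonneg_mult gamma_nonneg_run_series)
      ultimately show ?thesis
        by (simp only: S)
    qed
    then show ?thesis
      unfolding run_sum_rec[OF False] sum_distrib_right by (intro gamma_nonneg_sum) auto
  qed
qed

lemma run_sum_nth_0:
  assumes "S \<noteq> {}"
  shows "run_sum E p S $ 0 = 0"
  unfolding run_sum_rec[OF assms] by (simp add: fps_sum_nth run_series_def)

section \<open>Ehrhart series and Ehrhart polynomials\<close>

lemma edge_at_vertex:
  assumes "simple_graph E" and "no_isolated_vertices E"
  obtains j where "{i, j} \<in> E"
proof -
  obtain e where e: "e \<in> E" "i \<in> e" "card e = 2"
    using assms unfolding simple_graph_def no_isolated_vertices_def by blast
  then obtain x y where "e = {x, y}"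
    by (auto simp: card_2_iff)
  then show ?thesis
    using e that by (auto simp: insert_commute)
qed

lemma scaled_FRAC:
  assumes "simple_graph E" and "no_isolated_vertices E"
  shows "(\<lambda>x. real n *\<^sub>R x) ` FRAC E =
    {y. (\<forall>i. 0 \<le> y $ i) \<and> (\<forall>i j. {i, j} \<in> E \<longrightarrow> y $ i + y $ j \<le> real n)}" (is "_ = ?R")
proof
  have "real n * x + real n * y \<le> real n" if "x + y \<le> 1" for x y
    using mult_left_mono[OF that, of "real n"] by (simp add: distrib_left)
  then show "(\<lambda>x. real n *\<^sub>R x) ` FRAC E \<subseteq> ?R"
    by (auto simp: FRAC_def)
  show "?R \<subseteq> (\<lambda>x. real n *\<^sub>R x) ` FRAC E"
  proof
    fix y assume y: "y \<in> ?R"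
    show "y \<in> (\<lambda>x. real n *\<^sub>R x) ` FRAC E"
    proof (cases "n = 0")
      \<comment> \<open>For \<open>n = 0\<close> the scaled polytope is the origin, and the
        inequalities confine \<open>y\<close> to it because every vertex lies on an edge.\<close>
      case True
      have "y $ i = 0" for i
      proof -
        obtain j where "{i, j} \<in> E"
          using edge_at_vertex[OF assms] by blast
        then have "y $ i + y $ j \<le> 0" "0 \<le> y $ i" "0 \<le> y $ j"
          using y True by auto
        then show ?thesis
          by simp
      qed
      then have "y = real n *\<^sub>R 0"
        by (simp add: vec_eq_iff)
      then show ?thesis
        by (rule image_eqI) (simp add: FRAC_def)
    next
      case False
      have "y = real n *\<^sub>R ((1 / real n) *\<^sub>R y)"
        using False by simp
      moreover have "(1 / real n) *\<^sub>R y \<in> FRAC E"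
        using y False by (simp add: FRAC_def add_divide_distrib[symmetric])
      ultimately show ?thesis
        by (rule image_eqI)
    qed
  qed
qed

lemma ehrhart_count_FRAC:
  fixes E :: "'n::finite set set"
  assumes "simple_graph E" and "no_isolated_vertices E"
  shows "ehrhart_count (FRAC E) n =
    card {x :: 'n \<Rightarrow> nat. \<forall>i j. {i, j} \<in> E \<longrightarrow> x i + x j \<le> n}" (is "_ = card ?D")
proof -
  let ?f = "\<lambda>x :: 'n \<Rightarrow> nat. (\<chi> i. real (x i))"
  have "(\<lambda>x. real n *\<^sub>R x) ` FRAC E \<inter> integer_points = ?f ` ?D" (is "?A = _")
  proof
    show "?A \<subseteq> ?f ` ?D"
    proof
      fix y assume "y \<in> ?A"
      then have y: "\<And>i. 0 \<le> y $ i" "\<And>i. y $ i \<in> \<int>"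
        and le: "\<And>i j. {i, j} \<in> E \<Longrightarrow> y $ i + y $ j \<le> real n"
        by (auto simp: scaled_FRAC[OF assms] integer_points_def)
      have nth: "real (nat \<lfloor>y $ i\<rfloor>) = y $ i" for i
        using y[of i] by (auto elim!: Ints_cases)
      have "y = ?f (\<lambda>i. nat \<lfloor>y $ i\<rfloor>)"
        by (simp add: vec_eq_iff nth)
      moreover have "(\<lambda>i. nat \<lfloor>y $ i\<rfloor>) \<in> ?D"
      proof -
        have "real (nat \<lfloor>y $ i\<rfloor> + nat \<lfloor>y $ j\<rfloor>) \<le> real n" if "{i, j} \<in> E" for i j
          using le[OF that] by (simp add: nth del: of_nat_le_iff)
        then show ?thesis
          by (simp only: of_nat_le_iff) simp
      qed
      ultimately show "y \<in> ?f ` ?D"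
        by (rule image_eqI)
    qed
    show "?f ` ?D \<subseteq> ?A"
      by (auto simp: scaled_FRAC[OF assms] integer_points_def simp flip: of_nat_add)
  qed
  moreover have "inj_on ?f ?D"
    by (auto simp: inj_on_def vec_eq_iff fun_eq_iff)
  ultimately show ?thesis
    unfolding ehrhart_count_def by (simp add: card_image)
qed

text \<open>On 0, ..., n the substitution \<open>f\<close> has inverse \<open>g\<close>. An odd
  value \<open>f (x i)\<close> means 2 x_i > n; then x_j is at most n - x_i, which is below n / 2,
  so \<open>f (x j)\<close> is even and at most 2 (n - x_i) = \<open>f (x i) - 1\<close>.\<close>

lemma card_lattice_points_eq_labellings:
  fixes E :: "'n::finite set set"
  assumes "simple_graph E" and "no_isolated_vertices E"
  shows "card {x :: 'n \<Rightarrow> nat. \<forall>i j. {i, j} \<in> E \<longrightarrow> x i + x j \<le> n} =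
    card (labellings E False UNIV n)" (is "card ?D = card ?L")
proof -
  define f where "f a = (if 2 * a \<le> n then 2 * a else Suc (2 * (n - a)))" for a
  define g where "g b = (if even b then b div 2 else n - b div 2)" for b
  have gf: "g (f a) = a" if "a \<le> n" for a
    using that by (simp add: f_def g_def)
  have fg: "f (g b) = b" if "b \<le> n" for b
    using that unfolding f_def g_def by (auto elim!: evenE oddE)
  have f_le: "f a \<le> n" if "a \<le> n" for a
    using that by (auto simp: f_def)
  have le: "x i \<le> n" if "x \<in> ?D" for x i
  proof -
    obtain j where "{i, j} \<in> E"
      using edge_at_vertex[OF assms] by blast
    then have "x i + x j \<le> n"
      using that by blast
    then show ?thesis
      by simp
  qed
  have "bij_betw (\<lambda>x i. f (x i)) ?D ?L"
  proof (rule bij_betw_byWitness[where f' = "\<lambda>v i. g (v i)"])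
    show "\<forall>x\<in>?D. (\<lambda>i. g (f (x i))) = x"
      using gf le by blast
    show "\<forall>v\<in>?L. (\<lambda>i. f (g (v i))) = v"
      using fg by (auto simp: labellings_def)
    show "(\<lambda>x i. f (x i)) ` ?D \<subseteq> ?L"
    proof clarify
      fix x :: "'n \<Rightarrow> nat" assume x: "\<forall>i j. {i, j} \<in> E \<longrightarrow> x i + x j \<le> n"
      have "f (x j) < f (x i)" if "odd (f (x i))" "{i, j} \<in> E" for i j
      proof -
        have "x i + x j \<le> n"
          using x that by blast
        then show ?thesis
          using that(1) by (auto simp: f_def split: if_splits)
      qed
      then show "(\<lambda>i. f (x i)) \<in> ?L"
        using f_le le x by (auto simp: labellings_def)
    qed
    show "(\<lambda>v i. g (v i)) ` ?L \<subseteq> ?D"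
    proof clarify
      fix v i j assume v: "v \<in> ?L" and ij: "{i, j} \<in> E"
      then have "v i \<le> n" "v j \<le> n" "odd (v i) \<Longrightarrow> v j < v i" "odd (v j) \<Longrightarrow> v i < v j"
        by (auto simp: labellings_def insert_commute)
      then show "g (v i) + g (v j) \<le> n"
        unfolding g_def by (auto elim!: evenE oddE)
    qed
  qed
  then show ?thesis
    by (rule bij_betw_same_card)
qed

lemma ehrhart_series_FRAC:
  fixes E :: "'n::finite set set"
  assumes "simple_graph E" and "no_isolated_vertices E"
  shows "ehrhart_series (FRAC E) = labelling_series E False UNIV"
  by (rule fps_ext)
    (simp add: ehrhart_series_def labelling_series_def ehrhart_count_FRAC[OF assms]
      card_lattice_points_eq_labellings[OF assms] labellings_0 removable_def)

text \<open>The lowest run cannot be odd: its vertices would have no neighbours at all.\<close>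

lemma run_sum_True_UNIV:
  fixes E :: "'n::finite set set"
  assumes "simple_graph E" and "no_isolated_vertices E"
  shows "run_sum E True UNIV = 0"
proof -
  have none: "{B. removable E True UNIV B \<and> B \<noteq> {}} = {}"
    using edge_at_vertex[OF assms] unfolding removable_def by blast
  show ?thesis
    unfolding run_sum_rec[OF UNIV_not_empty] none by simp
qed

text \<open>Multiplying X (1 - X) F = \<open>run_sum E False UNIV\<close> by 1 + X completes 1 - X
  to 1 - X^2, so the numerator is (1 + X) c / X and h_j = c_(j+1) + c_j. Symmetry of c about d makes
  h symmetric about d - 1/2. The difference h_(j+1) - h_j is c_(j+2) - c_j, so monotonicity of c in
  steps of 2 gives monotonicity of h in steps of 1.\<close>

lemma ehrhart_series_FRAC_numerator:
  fixes E :: "'n::finite set set"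
  assumes "simple_graph E" and "no_isolated_vertices E"
  obtains h :: "nat \<Rightarrow> real" where
    "ehrhart_series (FRAC E) * (1 - fps_X ^ 2) ^ (CARD('n) + 1) = Abs_fps h"
    "\<And>j. 2 * CARD('n) \<le> j \<Longrightarrow> h j = 0"
    "\<And>j. j < 2 * CARD('n) \<Longrightarrow> h (2 * CARD('n) - 1 - j) = h j"
    "\<And>j. j + 2 \<le> CARD('n) \<Longrightarrow> h j \<le> h (j + 1)"
proof -
  let ?d = "CARD('n)" and ?u = "1 - fps_X ^ 2 :: real fps" and ?F = "ehrhart_series (FRAC E)"
  define c where "c = run_sum E False UNIV * ?u ^ ?d"
  define h where "h j = fps_nth c (j + 1) + fps_nth c j" for j
  have gamma: "gamma_nonneg ?d c"
    unfolding c_def by (rule gamma_nonneg_run_sum)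
  have c0: "fps_nth c 0 = 0"
    by (simp add: c_def run_sum_nth_0)
  have "fps_X * (1 - fps_X) * ?F = run_sum E False UNIV"
    by (simp add: ehrhart_series_FRAC[OF assms] labelling_series_run_sum run_sum_True_UNIV[OF assms])
  then have "(1 + fps_X) * c = (1 + fps_X) * (fps_X * (1 - fps_X) * ?F * ?u ^ ?d)"
    by (simp add: c_def)
  also have "\<dots> = fps_X * (?F * (((1 + fps_X) * (1 - fps_X)) * ?u ^ ?d))"
    by (simp only: mult_ac)
  also have "(1 + fps_X) * (1 - fps_X) = ?u"
    by (simp add: algebra_simps power2_eq_square)
  finally have eq: "fps_X * (?F * ?u ^ (?d + 1)) = (1 + fps_X) * c"
    by simp
  have "fps_nth (?F * ?u ^ (?d + 1)) j = h j" for j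
  proof -
    have "fps_nth (?F * ?u ^ (?d + 1)) j = fps_nth (fps_X * (?F * ?u ^ (?d + 1))) (j + 1)"
      by simp
    then show ?thesis
      unfolding eq by (simp add: distrib_right h_def)
  qed
  then have "?F * ?u ^ (?d + 1) = Abs_fps h"
    by (simp add: fps_ext)
  moreover have sym: "fps_nth c n = fps_nth c (2 * ?d - n)" if "n \<le> 2 * ?d" for n
    using gamma that by (rule gamma_nonneg_symmetric)
  have "h j = 0" if "2 * ?d \<le> j" for j
    using that sym[of "2 * ?d"] c0 gamma_nonneg_nth_eq_0[OF gamma]
    by (cases "j = 2 * ?d") (auto simp: h_def)
  moreover have "h (2 * ?d - 1 - j) = h j" if "j < 2 * ?d" for j
  proof -
    have "2 * ?d - 1 - j + 1 = 2 * ?d - j" "2 * ?d - 1 - j = 2 * ?d - (j + 1)"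
      using that by simp_all
    then show ?thesis
      using that sym[of j] sym[of "j + 1"] by (simp add: h_def)
  qed
  moreover have "h j \<le> h (j + 1)" if "j + 2 \<le> ?d" for j
    using gamma_nonneg_nth_mono[OF gamma that] by (simp add: h_def)
  ultimately show ?thesis
    by (rule that)
qed

section \<open>Bisection of series and the polynomials of their coefficients\<close>

text \<open>Multiplication by 1 - t^2 respects the parity of exponents and acts on either class as 1
  - t.\<close>

lemma fps_section_mult_power:
  fixes f :: "'a::comm_ring_1 fps"
  assumes "r < 2"
  shows "Abs_fps (\<lambda>n. fps_nth (f * (1 - fps_X ^ 2) ^ k) (2 * n + r)) =
    Abs_fps (\<lambda>n. fps_nth f (2 * n + r)) * (1 - fps_X) ^ k"
proof (induction k arbitrary: f)
  case (Suc k)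
  have step: "Abs_fps (\<lambda>n. fps_nth (f * (1 - fps_X ^ 2)) (2 * n + r)) =
      Abs_fps (\<lambda>n. fps_nth f (2 * n + r)) * (1 - fps_X)"
  proof (rule fps_ext)
    fix n
    show "fps_nth (Abs_fps (\<lambda>n. fps_nth (f * (1 - fps_X ^ 2)) (2 * n + r))) n =
        fps_nth (Abs_fps (\<lambda>n. fps_nth f (2 * n + r)) * (1 - fps_X)) n"
      using assms by (cases n) (simp_all add: right_diff_distrib fps_X_power_mult_right_nth)
  qed
  have f: "f * (1 - fps_X ^ 2) ^ Suc k = (f * (1 - fps_X ^ 2)) * (1 - fps_X ^ 2) ^ k"
    by (simp add: mult.assoc)
  show ?case
    unfolding f Suc.IH step by (simp add: mult.assoc)
qed simp

lemma fps_binomial_mult_one_minus_X_power: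
  "Abs_fps (\<lambda>n. of_nat (n + d choose d)) * (1 - fps_X) ^ (d + 1) = (1 :: 'a::comm_ring_1 fps)"
proof (induction d)
  case 0
  show ?case
    by (rule fps_ext) (simp add: right_diff_distrib)
next
  case (Suc d)
  have "Abs_fps (\<lambda>n. of_nat (n + Suc d choose Suc d)) * (1 - fps_X) =
      (Abs_fps (\<lambda>n. of_nat (n + d choose d)) :: 'a fps)"
  proof (rule fps_ext)
    fix n
    show "fps_nth (Abs_fps (\<lambda>n. of_nat (n + Suc d choose Suc d)) * (1 - fps_X)) n =
        fps_nth (Abs_fps (\<lambda>n. of_nat (n + d choose d)) :: 'a fps) n"
      by (cases n) (simp_all add: right_diff_distrib binomial_eq_0)
  qed
  then show ?case
    using Suc by (simp add: mult.assoc[symmetric])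
qed

definition gbinomial_poly :: "nat \<Rightarrow> real poly" where
  "gbinomial_poly d = smult (1 / fact d) (\<Prod>i = 0..<d. [:- real i, 1:])"

lemma poly_gbinomial_poly [simp]: "poly (gbinomial_poly d) x = x gchoose d"
  by (simp add: gbinomial_poly_def gbinomial_prod_rev poly_prod)

text \<open>
  The polynomial whose value at \<open>n\<close> is the \<open>n\<close>-th coefficient of
  \<open>(a\<^sub>0 + \<dots> + a\<^bsub>d-1\<^esub> t\<^bsup>d-1\<^esup>) / (1 - t)\<^bsup>d+1\<^esup>\<close>.
\<close>

definition series_poly :: "nat \<Rightarrow> (nat \<Rightarrow> real) \<Rightarrow> real poly" where
  "series_poly d a =
     (\<Sum>i<d. smult (a i) (pcompose (gbinomial_poly d) [:real d - real i, 1:]))"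

lemma poly_series_poly:
  "poly (series_poly d a) x = (\<Sum>i<d. a i * ((x + real d - real i) gchoose d))"
  by (simp add: series_poly_def poly_sum poly_pcompose algebra_simps)

lemma poly_series_poly_eq_nth:
  assumes "f * (1 - fps_X) ^ (d + 1) = Abs_fps a" and "\<And>n. d \<le> n \<Longrightarrow> a n = 0"
  shows "poly (series_poly d a) (real n) = fps_nth f n"
proof -
  let ?b = "\<lambda>i. a i * real (n + d - i choose d)"
  have "f = f * (1 - fps_X) ^ (d + 1) * Abs_fps (\<lambda>n. real (n + d choose d))"
    using fps_binomial_mult_one_minus_X_power[of d, where ?'a = real]
    by (simp add: mult.assoc mult.commute)
  then have "fps_nth f n = (\<Sum>i = 0..n. a i * real (n - i + d choose d))"
    unfolding assms(1) by (metis (no_types, lifting) fps_mult_nth fps_nth_Abs_fps sum.cong)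
  also have "\<dots> = (\<Sum>i = 0..n. ?b i)"
    by (intro sum.cong) auto
  also have "\<dots> = (\<Sum>i\<in>{0..n} \<inter> {..<d}. ?b i)"
  proof (intro sum.mono_neutral_right ballI)
    fix i assume "i \<in> {0..n} - {0..n} \<inter> {..<d}"
    then have "d \<le> i"
      by auto
    then show "?b i = 0"
      by (simp add: assms(2))
  qed auto
  \<comment> \<open>For n < i < d the upper entry n + d - i is less than d, so the added terms
    vanish.\<close>
  also have "\<dots> = (\<Sum>i<d. ?b i)"
    by (intro sum.mono_neutral_left) (auto intro: binomial_eq_0)
  also have "\<dots> = poly (series_poly d a) (real n)"
    unfolding poly_series_poly by (intro sum.cong) (simp_all add: binomial_gbinomial of_nat_diff)
  finally show ?thesis
    by simp
qed

text \<open>Negating the upper entry of each binomial coefficient gives the sign and replaces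
  \<open>i\<close> by \<open>d - 1 - i\<close>.\<close>

lemma poly_series_poly_reciprocity:
  assumes "d > 0"
  shows "poly (series_poly d (\<lambda>i. a (d - 1 - i))) x = (-1) ^ d * poly (series_poly d a) (- x - 2)"
proof -
  have "(- x - 2 + real d - real i) gchoose d = (-1) ^ d * ((x + real d - real (d - 1 - i)) gchoose d)"
    if "i < d" for i
  proof -
    have "- x - 2 + real d - real i = - (x + 2 + real i - real d)"
      by simp
    moreover have "x + 2 + real i - real d + real d - 1 = x + real d - real (d - 1 - i)"
      using that by (simp add: of_nat_diff)
    ultimately show ?thesis
      by (simp only: gbinomial_minus)
  qed
  then have "(-1) ^ d * poly (series_poly d a) (- x - 2) =
      (\<Sum>i<d. a i * ((x + real d - real (d - 1 - i)) gchoose d))"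
    unfolding poly_series_poly sum_distrib_left
    by (intro sum.cong) (simp_all flip: power_add mult.assoc add: mult.left_commute)
  also have "\<dots> = (\<Sum>i<d. a (d - 1 - i) * ((x + real d - real i) gchoose d))"
    by (rule sum.reindex_bij_witness[where i = "\<lambda>i. d - 1 - i" and j = "\<lambda>i. d - 1 - i"]) auto
  finally show ?thesis
    by (simp add: poly_series_poly)
qed

section \<open>The doubled polytope\<close>

lemma ehrhart_count_two_FRAC: "ehrhart_count (two_FRAC E) n = ehrhart_count (FRAC E) (2 * n)"
  by (simp add: ehrhart_count_def two_FRAC_def image_image mult.commute)

lemma ehrhart_series_FRAC_nth:
  fixes E :: "'n::finite set set"
  assumes "simple_graph E" and "no_isolated_vertices E"
  shows "fps_nth (ehrhart_series (FRAC E)) n = real (ehrhart_count (FRAC E) n)"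
  by (simp add: ehrhart_series_FRAC[OF assms] labelling_series_def ehrhart_count_FRAC[OF assms]
      card_lattice_points_eq_labellings[OF assms])

lemma ehrhart_series_two_FRAC:
  "ehrhart_series (two_FRAC E) = Abs_fps (\<lambda>n. fps_nth (ehrhart_series (FRAC E)) (2 * n))"
  by (rule fps_ext) (simp add: ehrhart_series_def ehrhart_count_two_FRAC)

text \<open>Points with all coordinates at most 1/2 satisfy every edge inequality, so the doubled
  polytope contains the open unit cube. Its dimension fixes the exponent in
  \<open>delta_poly\<close>.\<close>

lemma aff_dim_two_FRAC: "aff_dim (two_FRAC (E :: 'n::finite set set)) = int CARD('n)"
proof -
  have "box 0 1 \<subseteq> two_FRAC E"
  proof
    fix y :: "real ^ 'n" assume "y \<in> box 0 1"
    then have y: "0 < y $ i" "y $ i < 1" for i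
      by (auto simp: mem_box_cart)
    have "y $ i / 2 + y $ j / 2 \<le> 1" for i j
      using y[of i] y[of j] by simp
    then have "(1 / 2) *\<^sub>R y \<in> FRAC E"
      using y by (auto simp: FRAC_def less_imp_le)
    moreover have "y = 2 *\<^sub>R ((1 / 2) *\<^sub>R y)"
      by simp
    ultimately show "y \<in> two_FRAC E"
      unfolding two_FRAC_def by (rule rev_image_eqI)
  qed
  then have "box 0 1 \<subseteq> interior (two_FRAC E)"
    by (simp add: interior_maximal open_box)
  moreover have "(\<chi> i. 1 / 2) \<in> box 0 (1 :: real ^ 'n)"
    by (simp add: mem_box_cart)
  ultimately show ?thesis
    by (subst aff_dim_nonempty_interior) auto
qed

section \<open>Passage to Laurent series\<close>

lemma fps_to_fls_sum: "fps_to_fls (sum f A) = (\<Sum>x\<in>A. fps_to_fls (f x))"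
  by (induction A rule: infinite_finite_induct) auto

lemma fps_to_fls_Abs_fps_finite:
  fixes h :: "nat \<Rightarrow> 'a::comm_ring_1"
  assumes "\<And>j. n \<le> j \<Longrightarrow> h j = 0"
  shows "fps_to_fls (Abs_fps h) = (\<Sum>j<n. fls_const (h j) * fls_X ^ j)"
proof -
  have "Abs_fps h = (\<Sum>j<n. fps_const (h j) * fps_X ^ j)"
  proof (rule fps_ext)
    fix k
    show "fps_nth (Abs_fps h) k = fps_nth (\<Sum>j<n. fps_const (h j) * fps_X ^ j) k"
      using assms[of k] by (simp add: fps_sum_nth if_distrib cong: if_cong)
  qed
  then show ?thesis
    by (simp add: fps_to_fls_sum fls_times_fps_to_fls fps_to_fls_power)
qed

lemma poly_fls_eq_sum:
  fixes p :: "'a::comm_ring_1 poly"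
  assumes "\<And>i. n \<le> i \<Longrightarrow> coeff p i = 0"
  shows "poly_fls p x = (\<Sum>i<n. fls_const (coeff p i) * x ^ i)"
proof -
  have coeff: "coeff (map_poly fls_const p) i = fls_const (coeff p i)" for i
    by (simp add: coeff_map_poly)
  have "poly_fls p x = (\<Sum>i\<le>degree (map_poly fls_const p). fls_const (coeff p i) * x ^ i)"
    by (simp add: poly_fls_def poly_altdef coeff)
  also have "\<dots> = (\<Sum>i\<le>degree (map_poly fls_const p) + n. fls_const (coeff p i) * x ^ i)"
  proof (rule sum.mono_neutral_left)
    show "\<forall>i\<in>{..degree (map_poly fls_const p) + n} - {..degree (map_poly fls_const p)}.
        fls_const (coeff p i) * x ^ i = 0"
      using coeff_eq_0[of "map_poly fls_const p"] by (auto simp: coeff)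
  qed auto
  also have "\<dots> = (\<Sum>i<n. fls_const (coeff p i) * x ^ i)"
    using assms by (intro sum.mono_neutral_right) auto
  finally show ?thesis .
qed

lemma sum_lessThan_double:
  "(\<Sum>j<2 * n. f j) = (\<Sum>i<n. f (2 * i)) + (\<Sum>i<n. f (2 * i + 1))"
  for f :: "nat \<Rightarrow> 'a::comm_monoid_add"
  by (induction n) (simp_all add: ac_simps)

section \<open>The interleaved numerator, its unimodality, and reciprocity\<close>

theorem theorem3p1:
  fixes E :: "'n::finite set set" and d :: nat and \<delta> :: "real poly"
  assumes "simple_graph E" and "no_isolated_vertices E"
    and "d = CARD('n)"
    and "\<delta> = delta_poly (two_FRAC E)"
  shows "degree \<delta> \<le> d - 1 \<and>
    fps_to_fls (ehrhart_series (FRAC E)) =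
      (poly_fls \<delta> (fls_X ^ 2) + fls_X ^ (2 * d - 1) * poly_fls \<delta> (1 / fls_X ^ 2))
        / (1 - fls_X ^ 2) ^ (d + 1) \<and>
    fps_to_fls (ehrhart_series (FRAC E)) =
      (\<Sum>j=0..2*d-1. fls_const (interleaved d \<delta> j) * fls_X ^ j)
        / (1 - fls_X ^ 2) ^ (d + 1) \<and>
    symmetric_seq (2 * d - 1) (interleaved d \<delta>) \<and>
    unimodal_seq (2 * d - 1) (interleaved d \<delta>) \<and>
    (\<forall>k::int.
      poly (ehrhart_odd_poly (FRAC E)) (of_int (2 * k + 1)) =
        (-1) ^ d * poly (ehrhart_even_poly (FRAC E)) (of_int (- 2 * k - 4)) \<and>
      poly (ehrhart_odd_poly (FRAC E)) (of_int (2 * k + 1)) =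
        (-1) ^ d * poly (ehrhart_poly (two_FRAC E)) (of_int (- k - 2)))"
proof -
  note graph = assms(1,2)
  let ?F = "ehrhart_series (FRAC E)" and ?G = "ehrhart_series (two_FRAC E)"
  have d: "d > 0"
    by (simp add: assms(3) card_gt_0_iff)
  obtain h :: "nat \<Rightarrow> real" where
    series: "?F * (1 - fps_X ^ 2) ^ (d + 1) = Abs_fps h" and
    h_0: "\<And>j. 2 * d \<le> j \<Longrightarrow> h j = 0" and
    h_sym: "\<And>j. j < 2 * d \<Longrightarrow> h (2 * d - 1 - j) = h j" and
    h_mono: "\<And>j. j + 2 \<le> d \<Longrightarrow> h j \<le> h (j + 1)"
    using ehrhart_series_FRAC_numerator[OF graph] unfolding assms(3) by blast
  define a where "a i = h (2 * i)" for i
  \<comment> \<open>Reflection in the odd number 2d - 1 swaps parities, so the odd coefficients are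
    the even ones in reverse order.\<close>
  have h_odd: "h (2 * i + 1) = a (d - 1 - i)" if "i < d" for i
  proof -
    have "2 * d - 1 - (2 * i + 1) = 2 * (d - 1 - i)"
      using that by simp
    then show ?thesis
      using h_sym[of "2 * i + 1"] that by (simp add: a_def)
  qed
  have a_0: "a i = 0" if "d \<le> i" for i
    using that h_0 by (simp add: a_def)
  have even_series: "?G * (1 - fps_X) ^ (d + 1) = Abs_fps a"
    using fps_section_mult_power[of 0 ?F "d + 1"] unfolding series
    by (simp only: ehrhart_series_two_FRAC a_def[abs_def]) simp
  have odd_series: "Abs_fps (\<lambda>n. fps_nth ?F (2 * n + 1)) * (1 - fps_X) ^ (d + 1) =
      Abs_fps (\<lambda>i. h (2 * i + 1))"
    using fps_section_mult_power[of 1 ?F "d + 1"] unfolding series by simp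

  \<comment> \<open>By \<open>even_series\<close>, the even part of the numerator is the numerator
    for the doubled polytope over (1 - t)^(d+1).\<close>
  have coeff_\<delta>: "coeff \<delta> i = a i" for i
  proof -
    define p where "p = (\<Sum>i<d. monom (a i) i)"
    have coeff_p: "coeff p i = a i" for i
      using a_0[of i] by (simp add: p_def coeff_sum if_distrib cong: if_cong)
    have "fps_of_poly p = Abs_fps a"
      by (rule fps_ext) (simp add: coeff_p)
    then have "?G * (1 - fps_X) ^ (nat (aff_dim (two_FRAC E)) + 1) = fps_of_poly p"
      using even_series by (simp only: aff_dim_two_FRAC nat_int assms(3))
    moreover have "(1 - fps_X :: real fps) ^ k \<noteq> 0" for k
      by (rule fps_nonzeroI[of _ 0]) (simp add: fps_nth_power_0)
    ultimately have "?G = fps_of_poly p / (1 - fps_X) ^ (nat (aff_dim (two_FRAC E)) + 1)"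
      by (metis nonzero_mult_div_cancel_right)
    from delta_poly_eqI[OF this] show ?thesis
      by (simp add: assms(4) coeff_p)
  qed
  have interleaved: "interleaved d \<delta> j = h j" if "j < 2 * d" for j
  proof (cases "even j")
    case True
    then show ?thesis
      by (simp add: interleaved_def coeff_\<delta> a_def)
  next
    case False
    then obtain i where i: "j = 2 * i + 1"
      by (rule oddE)
    with that have "i < d"
      by simp
    from h_odd[OF this] show ?thesis
      by (simp add: interleaved_def coeff_\<delta> i)
  qed

  have degree: "degree \<delta> \<le> d - 1"
    using a_0 by (intro degree_le) (auto simp: coeff_\<delta>)

  have upto: "{0..2 * d - 1} = {..<2 * d}"
    using d by auto
  have "fps_to_fls ?F * (1 - fls_X ^ 2) ^ (d + 1) = fps_to_fls (Abs_fps h)"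
    unfolding series[symmetric] by (simp add: fls_times_fps_to_fls fps_to_fls_power)
  also have "\<dots> = (\<Sum>j<2 * d. fls_const (h j) * fls_X ^ j)"
    using h_0 by (rule fps_to_fls_Abs_fps_finite)
  finally have "fps_to_fls ?F * (1 - fls_X ^ 2) ^ (d + 1) =
      (\<Sum>j<2 * d. fls_const (h j) * fls_X ^ j)" .
  moreover have "(1 - fls_X ^ 2 :: real fls) ^ (d + 1) \<noteq> 0"
  proof -
    have "fps_to_fls ((1 - fps_X ^ 2 :: real fps) ^ (d + 1)) = (1 - fls_X ^ 2) ^ (d + 1)"
      by (simp add: fps_to_fls_power fls_times_fps_to_fls)
    moreover have "(1 - fps_X ^ 2 :: real fps) ^ (d + 1) \<noteq> 0"
      by (rule fps_nonzeroI[of _ 0]) (simp add: fps_nth_power_0)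
    ultimately show ?thesis
      by (metis fps_to_fls_eq_0_iff)
  qed
  ultimately have laurent: "fps_to_fls ?F =
      (\<Sum>j<2 * d. fls_const (h j) * fls_X ^ j) / (1 - fls_X ^ 2) ^ (d + 1)"
    by (rule eq_divide_imp[rotated])
  have sum1: "(\<Sum>j=0..2*d-1. fls_const (interleaved d \<delta> j) * fls_X ^ j) =
      (\<Sum>j<2 * d. fls_const (h j) * fls_X ^ j)"
    unfolding upto by (intro sum.cong) (auto simp: interleaved)
  have sum2: "poly_fls \<delta> (fls_X ^ 2) + fls_X ^ (2 * d - 1) * poly_fls \<delta> (1 / fls_X ^ 2) =
      (\<Sum>j<2 * d. fls_const (h j) * fls_X ^ j)"
  proof -
    have poly_\<delta>: "poly_fls \<delta> x = (\<Sum>i<d. fls_const (a i) * x ^ i)" for x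
      using poly_fls_eq_sum[of d \<delta> x] a_0 by (simp add: coeff_\<delta>)
    \<comment> \<open>The second summand supplies the odd exponents: reversing the index turns 2d -
      1 - 2i into 2i + 1, and \<open>h_odd\<close> identifies the coefficients.\<close>
    have "fls_X ^ (2 * d - 1) * poly_fls \<delta> (1 / fls_X ^ 2) =
        (\<Sum>i<d. fls_const (a i) * fls_X ^ (2 * d - 1 - 2 * i))"
      unfolding poly_\<delta> sum_distrib_left
    proof (intro sum.cong refl)
      fix i assume "i \<in> {..<d}"
      then have "2 * d - 1 = (2 * d - 1 - 2 * i) + 2 * i"
        by simp
      then have split: "fls_X ^ (2 * d - 1) =
          fls_X ^ (2 * d - 1 - 2 * i) * (fls_X :: real fls) ^ (2 * i)"
        by (metis power_add)
      have "x ^ (2 * i) * (1 / x ^ 2) ^ i = 1" if "x \<noteq> 0" for x :: "real fls"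
        using that by (simp add: power_divide power_mult)
      then have cancel: "fls_X ^ (2 * i) * (1 / fls_X ^ 2) ^ i = (1 :: real fls)"
        using fls_X_nonzero by blast
      have "fls_X ^ (2 * d - 1) * (fls_const (a i) * (1 / fls_X ^ 2) ^ i) =
          fls_const (a i) * fls_X ^ (2 * d - 1 - 2 * i) * (fls_X ^ (2 * i) * (1 / fls_X ^ 2) ^ i)"
        unfolding split by (simp only: mult_ac)
      then show "fls_X ^ (2 * d - 1) * (fls_const (a i) * (1 / fls_X ^ 2) ^ i) =
          fls_const (a i) * fls_X ^ (2 * d - 1 - 2 * i)"
        unfolding cancel by (simp only: mult_1_right)
    qed
    also have "\<dots> = (\<Sum>i<d. fls_const (a (d - Suc i)) * fls_X ^ (2 * d - 1 - 2 * (d - Suc i)))"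
      by (rule sum.nat_diff_reindex[symmetric])
    also have "\<dots> = (\<Sum>i<d. fls_const (h (2 * i + 1)) * fls_X ^ (2 * i + 1))"
    proof (intro sum.cong refl)
      fix i assume "i \<in> {..<d}"
      then have "2 * d - 1 - 2 * (d - Suc i) = 2 * i + 1" "a (d - Suc i) = h (2 * i + 1)"
        using h_odd[of i] by auto
      then show "fls_const (a (d - Suc i)) * fls_X ^ (2 * d - 1 - 2 * (d - Suc i)) =
          fls_const (h (2 * i + 1)) * fls_X ^ (2 * i + 1)"
        by (simp only:)
    qed
    finally show ?thesis
      by (simp add: sum_lessThan_double poly_\<delta> a_def power_mult)
  qed

  have symmetric: "symmetric_seq (2 * d - 1) (interleaved d \<delta>)"
    using d h_sym by (auto simp: symmetric_seq_def interleaved)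

  have unimodal: "unimodal_seq (2 * d - 1) (interleaved d \<delta>)"
    unfolding unimodal_seq_def
  \<comment> \<open>The two middle entries, at d - 1 and d, are equal by symmetry; the first serves
    as the peak, and the descent mirrors the ascent.\<close>
  proof (intro exI[of _ "d - 1"] conjI allI impI)
    show "d - 1 \<le> 2 * d - 1"
      by simp
  next
    fix i assume "i < d - 1"
    then show "interleaved d \<delta> i \<le> interleaved d \<delta> (Suc i)"
      using h_mono[of i] by (simp add: interleaved)
  next
    fix i assume i: "d - 1 \<le> i \<and> i < 2 * d - 1"
    have refl: "h i = h (2 * d - 1 - i)" "h (Suc i) = h (2 * d - 1 - Suc i)"
      using i h_sym[of i] h_sym[of "Suc i"] by auto
    have "h (Suc i) \<le> h i"
    proof (cases "i = d - 1")
      case True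
      then show ?thesis
        using refl d by simp
    next
      case False
      then have "2 * d - 1 - Suc i + 2 \<le> d" "2 * d - 1 - Suc i + 1 = 2 * d - 1 - i"
        using i by auto
      then show ?thesis
        unfolding refl using h_mono by metis
    qed
    moreover have "i < 2 * d" "Suc i < 2 * d"
      using i by auto
    ultimately show "interleaved d \<delta> (Suc i) \<le> interleaved d \<delta> i"
      by (simp only: interleaved)
  qed

  define P where "P = series_poly d a"
  define Q where "Q = series_poly d (\<lambda>i. h (2 * i + 1))"
  have P: "poly P (real n) = real (ehrhart_count (FRAC E) (2 * n))" for n
    unfolding P_def using poly_series_poly_eq_nth[OF even_series a_0]
    by (simp add: ehrhart_series_two_FRAC ehrhart_series_FRAC_nth[OF graph])
  have Q: "poly Q (real n) = real (ehrhart_count (FRAC E) (2 * n + 1))" for n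
    unfolding Q_def using poly_series_poly_eq_nth[OF odd_series] h_0
    by (simp add: ehrhart_series_FRAC_nth[OF graph])
  \<comment> \<open>The coefficients of \<open>Q\<close> are those of \<open>P\<close> reversed,
    which is the situation of \<open>poly_series_poly_reciprocity\<close>.\<close>
  have QP: "poly Q x = (-1) ^ d * poly P (- x - 2)" for x
  proof -
    have "Q = series_poly d (\<lambda>i. a (d - 1 - i))"
      using h_odd by (simp add: Q_def series_poly_def)
    then show ?thesis
      using poly_series_poly_reciprocity[OF d] by (simp add: P_def)
  qed
  have "ehrhart_poly (two_FRAC E) = P"
    by (rule ehrhart_poly_eqI) (simp add: P ehrhart_count_two_FRAC)
  then have poly_two_FRAC: "poly (ehrhart_poly (two_FRAC E)) x = poly P x" for x
    by simp
  have "ehrhart_even_poly (FRAC E) = pcompose P [:0, 1 / 2:]"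
    by (rule ehrhart_even_poly_eqI) (auto simp: poly_pcompose P elim!: evenE)
  then have poly_even: "poly (ehrhart_even_poly (FRAC E)) x = poly P (x / 2)" for x
    by (simp add: poly_pcompose)
  \<comment> \<open>\<open>P\<close> and \<open>Q\<close> are indexed by n with arguments 2n and 2n
    + 1, so the odd polynomial is \<open>Q\<close> at (x - 1) / 2, as the even one is
    \<open>P\<close> at x / 2.\<close>
  have shift: "poly (pcompose Q [:- 1 / 2, 1 / 2:]) (2 * x + 1) = poly Q x" for x
    by (simp add: poly_pcompose add_divide_distrib)
  have "ehrhart_odd_poly (FRAC E) = pcompose Q [:- 1 / 2, 1 / 2:]"
  proof (rule ehrhart_odd_poly_eqI)
    fix n :: nat assume "odd n"
    then obtain m where n: "n = 2 * m + 1"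
      by (rule oddE)
    have "real n = 2 * real m + 1"
      by (simp add: n)
    then show "poly (pcompose Q [:- 1 / 2, 1 / 2:]) (real n) = real (ehrhart_count (FRAC E) n)"
      using Q[of m] by (simp only: shift n)
  qed
  then have poly_odd: "poly (ehrhart_odd_poly (FRAC E)) (2 * x + 1) = poly Q x" for x
    using shift by simp
  have reciprocity: "poly (ehrhart_odd_poly (FRAC E)) (of_int (2 * k + 1)) =
        (-1) ^ d * poly (ehrhart_even_poly (FRAC E)) (of_int (- 2 * k - 4)) \<and>
      poly (ehrhart_odd_poly (FRAC E)) (of_int (2 * k + 1)) =
        (-1) ^ d * poly (ehrhart_poly (two_FRAC E)) (of_int (- k - 2))" for k :: int
  proof -
    \<comment> \<open>All three values reduce to \<open>P\<close> at -k - 2; the even argument -2k -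
      4 is twice that.\<close>
    have "real_of_int (2 * k + 1) = 2 * real_of_int k + 1"
      "real_of_int (- k - 2) = - real_of_int k - 2"
      "real_of_int (- 2 * k - 4) / 2 = - real_of_int k - 2"
      by simp_all
    then show ?thesis
      by (simp only: poly_two_FRAC poly_even poly_odd QP)
  qed
  show ?thesis
    unfolding sum1 sum2
    by (intro conjI allI degree laurent symmetric unimodal conjunct1[OF reciprocity]
        conjunct2[OF reciprocity])
qed

end
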